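(* Let $A$ be a finite alphabet and let $w$ be a recurrent infinite word over $A$. The following assertions are equivalent: (1) $w$ is episturmian; (2) for each factor $u$ of $w$, there exists a letter $a$ such that $AuA \cap Fact(w) \subseteq auA \cup Aua$; (3) for each palindromic factor $u$ of $w$, there exists a letter $a$ such that $AuA \cap Fact(w) \subseteq auA \cup Aua$.
   Context: $Fact(w)$ denotes the set of factors of $w$; $AuA=\{xuy : x,y\in A\}$, $auA=\{auy: y\in A\}$, $Aua=\{xua : x\in A\}$. An infinite word is recurrent if each of its factors occurs infinitely often. A palindrome is a word equal to its mirror image. A factor $u$ of $w$ is left special if there are two different letters $a,b$ with $au$ and $bu$ factors of $w$. An infinite word $w$ is episturmian if $Fact(w)$ is closed under mirror image and $w$ has at most one left special factor of each length. *)

theory Defs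
  imports "HOL-Library.Omega_Words_Fun"
begin

(* Infinite words are of type nat => 'a and finite words are lists; w [i -> j] is the finite
   word w_i ... w_{j-1}. The empty word (i >= j) counts as a factor. *)

definition Fact :: "'a word \<Rightarrow> 'a list set" where
  "Fact w = {w [i \<rightarrow> j] | i j. True}"

definition recurrent :: "'a word \<Rightarrow> bool" where
  "recurrent w \<longleftrightarrow> (\<forall>u\<in>Fact w. infinite {i. w [i \<rightarrow> i + length u] = u})"

definition palindrome :: "'a list \<Rightarrow> bool" where
  "palindrome u \<longleftrightarrow> u = rev u"

definition left_special :: "'a word \<Rightarrow> 'a list \<Rightarrow> bool" where
  "left_special w u \<longleftrightarrow>
     u \<in> Fact w \<and> (\<exists>a b. a \<noteq> b \<and> a # u \<in> Fact w \<and> b # u \<in> Fact w)"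

definition episturmian :: "'a word \<Rightarrow> bool" where
  "episturmian w \<longleftrightarrow>
     (\<forall>u\<in>Fact w. rev u \<in> Fact w) \<and>
     (\<forall>n. \<exists>\<^sub>\<le>\<^sub>1 u. left_special w u \<and> length u = n)"

(* The set XuY of words. In particular auA is ext_set {a} u A and Aua is ext_set A u {a}. *)

definition ext_set :: "'a set \<Rightarrow> 'a list \<Rightarrow> 'a set \<Rightarrow> 'a list set" where
  "ext_set X u Y = {x # u @ [y] | x y. x \<in> X \<and> y \<in> Y}"

end

theory Submission
  imports Defs "HOL-Library.Sublist"
begin

text \<open>If every palindromic factor is dominated by a letter, then closure under reversal for
  length \<open>n + 1\<close> and uniqueness of the left special factor of length \<open>n\<close> propagate together by
  induction: only bispecial factors matter, and these are palindromes. Conversely, in an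
  episturmian word a bispecial factor \<open>u\<close> is a palindrome all of whose complete returns are
  palindromes. If \<open>c u d\<close> occurs but neither \<open>u c\<close> nor \<open>u d\<close> is left special, the letters
  around \<open>u\<close> are then forced to be \<open>c\<close> and \<open>d\<close> forever, and by recurrence this
  is the whole word.\<close>

section \<open>Factors of recurrent words\<close>

lemma Fact_factor:
  assumes "p @ u @ q \<in> Fact w"
  shows "u \<in> Fact w"
proof -
  obtain i j where ij: "p @ u @ q = (w [i \<rightarrow> j])"
    using assms by (auto simp: Fact_def)
  have len: "length p + length u + length q = j - i"
    using arg_cong[OF ij, of length] by (simp add: subsequence_def)
  have "u = (w [i + length p \<rightarrow> i + length p + length u])"
  proof (rule nth_equalityI)
    fix k assume k: "k < length u"
    have "u ! k = (p @ u @ q) ! (length p + k)"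
      using k by (simp add: nth_append)
    also have "\<dots> = w (i + (length p + k))"
      unfolding ij subsequence_def using k len by (subst nth_map) auto
    finally show "u ! k = (w [i + length p \<rightarrow> i + length p + length u]) ! k"
      using k by (simp add: subsequence_def add.assoc)
  qed (simp add: subsequence_def)
  then show ?thesis
    unfolding Fact_def by blast
qed

lemma Fact_appendD1: "u @ v \<in> Fact w \<Longrightarrow> u \<in> Fact w"
  using Fact_factor[of "[]" u v] by simp

lemma Fact_appendD2: "u @ v \<in> Fact w \<Longrightarrow> v \<in> Fact w"
  using Fact_factor[of u v "[]"] by simp

lemma Fact_ConsD: "c # u \<in> Fact w \<Longrightarrow> u \<in> Fact w"
  using Fact_appendD2[of "[c]" u] by simp

lemma letter_in_Fact: "[w i] \<in> Fact w"
proof -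
  have "[w i] = (w [i \<rightarrow> Suc i])"
    by (simp add: subsequence_def)
  then show ?thesis
    unfolding Fact_def by blast
qed

lemma set_Fact: "u \<in> Fact w \<Longrightarrow> set u \<subseteq> range w"
  unfolding Fact_def by (auto simp: subsequence_def)

text \<open>Recurrence supplies an occurrence of \<open>v\<close> that starts after an occurrence of
  \<open>u\<close> has ended; \<open>s\<close> is the gap. The bound \<open>max i j\<close> covers
  the empty \<open>u\<close>, whose \<open>i\<close> may exceed \<open>j\<close>.\<close>

lemma recurrent_connect:
  assumes "recurrent w" "u \<in> Fact w" "v \<in> Fact w"
  shows "\<exists>s. u @ s @ v \<in> Fact w"
proof -
  obtain i j where ij: "u = (w [i \<rightarrow> j])"
    using assms by (auto simp: Fact_def)
  have "infinite {k. w [k \<rightarrow> k + length v] = v}"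
    using assms by (auto simp: recurrent_def)
  then obtain k where k: "k \<ge> max i j" "(w [k \<rightarrow> k + length v]) = v"
    unfolding infinite_nat_iff_unbounded_le by blast
  have "[max i j..<k + length v] = [max i j..<k] @ [k..<k + length v]"
    using k by (intro upt_add_eq_append) simp
  moreover have "[i..<k + length v] = [i..<j] @ [max i j..<k + length v]"
  proof (cases "i \<le> j")
    case True
    then show ?thesis
      using k upt_add_eq_append[of i j "k + length v - j"] by (simp add: max_def)
  qed (simp add: max_def)
  ultimately have "u @ (w [max i j \<rightarrow> k]) @ v = (w [i \<rightarrow> k + length v])"
    unfolding ij by (metis k(2) map_append subsequence_def)
  then show ?thesis
    unfolding Fact_def by blast
qed

lemma recurrent_extend_right:
  assumes "recurrent w" "u \<in> Fact w"
  shows "\<exists>d. u @ [d] \<in> Fact w"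
proof -
  obtain s where s: "u @ s @ [w 0] \<in> Fact w"
    using recurrent_connect[OF assms letter_in_Fact] by blast
  obtain d t where "s @ [w 0] = d # t"
    by (cases "s @ [w 0]") auto
  then show ?thesis
    using s Fact_appendD1[of "u @ [d]" t w] by auto
qed

lemma recurrent_extend_left:
  assumes "recurrent w" "u \<in> Fact w"
  shows "\<exists>c. c # u \<in> Fact w"
proof -
  obtain s where s: "[w 0] @ s @ u \<in> Fact w"
    using recurrent_connect[OF assms(1) letter_in_Fact assms(2)] by blast
  obtain c t where "[w 0] @ s = t @ [c]"
    by (cases "[w 0] @ s" rule: rev_cases) auto
  then have "t @ (c # u) \<in> Fact w"
    using s by (metis append.assoc append_Cons append_Nil)
  then show ?thesis
    using Fact_appendD2 by blast
qed

section \<open>Special factors and dominating letters\<close>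

lemma left_specialI:
  assumes "a # u \<in> Fact w" "b # u \<in> Fact w" "a \<noteq> b"
  shows "left_special w u"
  using assms Fact_ConsD[OF assms(1)] unfolding left_special_def by blast

lemma left_special_prefix:
  assumes "left_special w (u @ v)"
  shows "left_special w u"
proof -
  obtain a b where ab: "a \<noteq> b" "(a # u) @ v \<in> Fact w" "(b # u) @ v \<in> Fact w"
    using assms unfolding left_special_def by auto
  show ?thesis
    by (rule left_specialI[OF ab(2,3)[THEN Fact_appendD1] ab(1)])
qed

definition right_special :: "'a word \<Rightarrow> 'a list \<Rightarrow> bool" where
  "right_special w u \<longleftrightarrow> (\<exists>a b. a \<noteq> b \<and> u @ [a] \<in> Fact w \<and> u @ [b] \<in> Fact w)"

lemma right_specialI:
  assumes "u @ [a] \<in> Fact w" "u @ [b] \<in> Fact w" "a \<noteq> b"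
  shows "right_special w u"
  using assms unfolding right_special_def by blast

lemma right_special_suffix:
  assumes "right_special w (u @ v)"
  shows "right_special w v"
  using assms unfolding right_special_def by (metis Fact_appendD2 append.assoc)

text \<open>This is the inclusion in assertions (2) and (3), freed from the alphabet
  \<open>A\<close>.\<close>

definition dominates :: "'a word \<Rightarrow> 'a \<Rightarrow> 'a list \<Rightarrow> bool" where
  "dominates w a u \<longleftrightarrow> (\<forall>c d. c # u @ [d] \<in> Fact w \<longrightarrow> c = a \<or> d = a)"

text \<open>One of the two letters to the left of \<open>u @ [b]\<close> differs from
  \<open>a\<close>, so domination must act on the right.\<close>

lemma dominates_left_special:
  assumes "dominates w a u" "left_special w (u @ [b])"
  shows "a = b"
  using assms unfolding dominates_def left_special_def by metis

lemma ex_ext_set_iff_dominates: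
  assumes "range w \<subseteq> A"
  shows "(\<exists>a\<in>A. ext_set A u A \<inter> Fact w \<subseteq> ext_set {a} u A \<union> ext_set A u {a})
           \<longleftrightarrow> (\<exists>a. dominates w a u)"
proof
  assume "\<exists>a\<in>A. ext_set A u A \<inter> Fact w \<subseteq> ext_set {a} u A \<union> ext_set A u {a}"
  then obtain a where a: "ext_set A u A \<inter> Fact w \<subseteq> ext_set {a} u A \<union> ext_set A u {a}"
    by blast
  have "c = a \<or> d = a" if "c # u @ [d] \<in> Fact w" for c d
  proof -
    have "c \<in> A" "d \<in> A"
      using set_Fact[OF that] assms by auto
    then have "c # u @ [d] \<in> ext_set A u A"
      by (auto simp: ext_set_def)
    then show ?thesis
      using a that by (auto simp: ext_set_def)
  qed
  then show "\<exists>a. dominates w a u"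
    unfolding dominates_def by blast
next
  assume "\<exists>a. dominates w a u"
  then obtain a where a: "dominates w a u" by blast
  \<comment> \<open>If \<open>a\<close> lies outside \<open>A\<close>, it occurs in no factor, so
    \<open>u\<close> has no two-sided extension and any letter of \<open>A\<close> will do.\<close>
  define b where "b = (if a \<in> A then a else w 0)"
  have "b \<in> A"
    using assms by (auto simp: b_def)
  moreover have "ext_set A u A \<inter> Fact w \<subseteq> ext_set {b} u A \<union> ext_set A u {b}"
    using a by (auto simp: ext_set_def dominates_def b_def)
  ultimately show "\<exists>a\<in>A. ext_set A u A \<inter> Fact w \<subseteq> ext_set {a} u A \<union> ext_set A u {a}"
    by blast
qed


section \<open>From dominated palindromes to episturmian words\<close>

text \<open>Reversal runs one length ahead: to see that a bispecial \<open>u\<close> of length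
  \<open>n\<close> is a palindrome, its one-letter extensions, of length \<open>n + 1\<close>, are
  reversed.\<close>

lemma dominated_palindromes_step:
  assumes rec: "recurrent w"
    and dom: "\<And>u. u \<in> Fact w \<Longrightarrow> palindrome u \<Longrightarrow> \<exists>a. dominates w a u"
  shows "(\<forall>z\<in>Fact w. length z \<le> Suc n \<longrightarrow> rev z \<in> Fact w) \<and>
         (\<exists>\<^sub>\<le>\<^sub>1 u. left_special w u \<and> length u = n)"
proof (induction n)
  case 0
  have "rev z = z" if "length z \<le> 1" for z :: "'a list"
    using that by (cases z) auto
  then show ?case
    by (auto simp: Uniq_def)
next
  case (Suc n)
  have closed: "rev z \<in> Fact w" if "z \<in> Fact w" "length z \<le> Suc n" for z
    using Suc that by blast
  have uniq: "x = y" if "left_special w x" "left_special w y" "length x = n" "length y = n" for x y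
    using Suc that by (auto dest: Uniq_D)
  have bispecial: "palindrome u"
    if u: "left_special w u" "right_special w u" "length u = n" for u
  proof -
    obtain a b where ab: "a \<noteq> b" "u @ [a] \<in> Fact w" "u @ [b] \<in> Fact w"
      using u(2) unfolding right_special_def by blast
    have "left_special w (rev u)"
      using closed[OF ab(2)] closed[OF ab(3)] ab(1) u(3) by (auto intro: left_specialI)
    then show ?thesis
      using uniq[of u "rev u"] u unfolding palindrome_def by simp
  qed
  have "rev z \<in> Fact w" if z: "z \<in> Fact w" "length z = Suc (Suc n)" for z
  proof -
    obtain c u d where zd: "z = c # u @ [d]"
      using z(2) by (metis length_Suc_conv_rev length_Suc_conv)
    have len: "length u = n" using z zd by simp
    have cu: "c # u \<in> Fact w" using z zd Fact_appendD1[of "c # u" "[d]"] by simp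
    have ud: "u @ [d] \<in> Fact w" using z zd Fact_ConsD[of c "u @ [d]"] by simp
    have rcu: "rev u @ [c] \<in> Fact w" using closed[OF cu] len by simp
    have rud: "d # rev u \<in> Fact w" using closed[OF ud] len by simp
    obtain y where y: "d # rev u @ [y] \<in> Fact w"
      using recurrent_extend_right[OF rec rud] by auto
    obtain x where x: "x # rev u @ [c] \<in> Fact w"
      using recurrent_extend_left[OF rec rcu] by auto
    \<comment> \<open>If \<open>u\<close> is not left special then \<open>y = c\<close>; if it is
      not right special then \<open>x = d\<close>. If it is bispecial, \<open>a\<close> is
      \<open>c\<close> or \<open>d\<close>, and domination applied to the words with
      \<open>x\<close> and \<open>y\<close> forces \<open>y = c\<close>, \<open>x = d\<close> or
      \<open>c = d\<close>.\<close>
    have "d # rev u @ [c] \<in> Fact w"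
    proof (cases "left_special w u \<and> right_special w u")
      case False
      have yu: "y # u \<in> Fact w"
        using closed[of "rev u @ [y]"] Fact_ConsD[OF y] len by simp
      have "x # rev u \<in> Fact w"
        using Fact_appendD1[of "x # rev u" "[c]"] x by simp
      then have ux: "u @ [x] \<in> Fact w"
        using closed[of "x # rev u"] len by simp
      show ?thesis
        using False left_specialI[OF yu cu] right_specialI[OF ux ud] x y by blast
    next
      case True
      then have pal: "rev u = u"
        using bispecial len unfolding palindrome_def by simp
      obtain a where "dominates w a u"
        using dom True bispecial len unfolding left_special_def by blast
      then show ?thesis
        using x y z zd pal unfolding dominates_def by metis
    qed
    then show ?thesis by (simp add: zd)
  qed
  moreover have "x = y" if xy: "left_special w x" "left_special w y"
    "length x = Suc n" "length y = Suc n" for x y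
  proof -
    obtain u b where u: "x = u @ [b]" "length u = n"
      using xy(3) by (metis length_Suc_conv_rev)
    obtain v c where v: "y = v @ [c]" "length v = n"
      using xy(4) by (metis length_Suc_conv_rev)
    have lu: "left_special w u" and "left_special w v"
      using xy u v left_special_prefix by auto
    then have "v = u"
      using uniq u v by blast
    show ?thesis
    proof (rule ccontr)
      \<comment> \<open>Both words extend the same \<open>u\<close>, which is then bispecial; the
        letter dominating it would equal both \<open>b\<close> and \<open>c\<close>.\<close>
      assume "x \<noteq> y"
      then have bc: "b \<noteq> c" using u v \<open>v = u\<close> by simp
      have "u @ [b] \<in> Fact w" "u @ [c] \<in> Fact w"
        using xy u v \<open>v = u\<close> unfolding left_special_def by auto
      then have "palindrome u"
        using bispecial lu u bc right_specialI by metis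
      then obtain a where "dominates w a u"
        using dom lu unfolding left_special_def by blast
      then show False
        using xy u v \<open>v = u\<close> bc dominates_left_special by metis
    qed
  qed
  ultimately show ?case
    using closed by (auto simp: Uniq_def le_Suc_eq)
qed

lemma episturmian_if_dominated_palindromes:
  assumes "recurrent w"
    and "\<And>u. u \<in> Fact w \<Longrightarrow> palindrome u \<Longrightarrow> \<exists>a. dominates w a u"
  shows "episturmian w"
  using dominated_palindromes_step[OF assms] unfolding episturmian_def
  by (meson le_SucI order_refl)


section \<open>Complete returns\<close>

text \<open>The two occurrences of \<open>u\<close> may overlap. For \<open>u = []\<close> the
  complete returns are the single letters.\<close>

definition complete_return :: "'a list \<Rightarrow> 'a list \<Rightarrow> bool" where
  "complete_return u r \<longleftrightarrow> r \<noteq> u \<and> prefix u r \<and> suffix u r \<and>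
     (\<forall>p q. r = p @ u @ q \<longrightarrow> p = [] \<or> q = [])"

lemma complete_return_rev:
  assumes "complete_return u r"
  shows "complete_return (rev u) (rev r)"
  unfolding complete_return_def
proof (intro conjI allI impI)
  fix p q assume "rev r = p @ rev u @ q"
  then have "r = rev q @ u @ rev p"
    by (metis append.assoc rev_append rev_rev_ident)
  then show "p = [] \<or> q = []"
    using assms unfolding complete_return_def by (metis rev_is_Nil_conv)
qed (use assms in \<open>auto simp: complete_return_def suffix_to_prefix\<close>)

lemma complete_return_ends:
  assumes "complete_return u r"
  obtains d s e t where "r = u @ d # s" "r = t @ e # u"
proof -
  obtain s' t' where st: "r = u @ s'" "r = t' @ u"
    using assms unfolding complete_return_def prefix_def suffix_def by blast
  moreover have "s' \<noteq> []" "t' \<noteq> []"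
    using assms st unfolding complete_return_def by auto
  ultimately show thesis
    using that by (metis append.assoc append_Cons append_Nil append_butlast_last_id list.exhaust)
qed

text \<open>Take the shortest prefix of \<open>z\<close> other than \<open>u\<close> that begins and
  ends with \<open>u\<close>: an inner occurrence of \<open>u\<close> would give a shorter
  one.\<close>

lemma ex_complete_return:
  assumes "prefix u z" "suffix u z" "z \<noteq> u"
  obtains r where "complete_return u r" "prefix r z"
proof -
  let ?P = "\<lambda>r. prefix r z \<and> prefix u r \<and> suffix u r \<and> r \<noteq> u"
  obtain r where r: "?P r" and min: "\<And>r'. ?P r' \<Longrightarrow> length r \<le> length r'"
    using ex_has_least_nat[of ?P z length] assms by auto
  have "p = [] \<or> q = []" if pq: "r = p @ u @ q" for p q
  proof (rule ccontr)
    assume neq: "\<not> ?thesis"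
    have "prefix (p @ u) r" using pq by simp
    moreover then have "prefix u (p @ u)"
      using r by (metis le_add2 length_append prefix_length_prefix)
    ultimately have "?P (p @ u)"
      using r neq by (auto simp: suffix_def intro: prefix_order.trans)
    then show False
      using min[of "p @ u"] pq neq by simp
  qed
  then show thesis
    using r that unfolding complete_return_def by blast
qed

text \<open>Where two complete returns diverge, a right special factor ends, and its suffix of
  length \<open>length u\<close> would be an inner occurrence of \<open>u\<close>.\<close>

lemma complete_return_unique:
  assumes uniq: "\<And>x. right_special w x \<Longrightarrow> length x = length u \<Longrightarrow> x = u"
    and r: "complete_return u r" "r \<in> Fact w" "prefix (u @ [d]) r"
    and r': "complete_return u r'" "r' \<in> Fact w" "prefix (u @ [d]) r'"
  shows "r = r'"
proof (rule ccontr)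
  assume neq: "r \<noteq> r'"
  \<comment> \<open>In a proper continuation of \<open>x\<close>, the last \<open>u\<close> of
    \<open>x\<close> would be an inner occurrence.\<close>
  have no_prefix: "x = y"
    if x: "complete_return u x" and y: "complete_return u y" and xy: "prefix x y" for x y
  proof -
    obtain q where q: "y = x @ q" using xy by (auto simp: prefix_def)
    obtain e t where t: "x = (t @ [e]) @ u"
      using complete_return_ends[OF x] by (metis append.assoc append_Cons append_Nil)
    have "y = (t @ [e]) @ u @ q" using q t by simp
    then have "t @ [e] = [] \<or> q = []"
      using y unfolding complete_return_def by blast
    then show ?thesis using q by simp
  qed
  have "r \<parallel> r'"
    using neq no_prefix[OF r(1) r'(1)] no_prefix[OF r'(1) r(1)] by (auto simp: parallel_def)
  then obtain p a b q q' where div: "a \<noteq> b" "r = p @ a # q" "r' = p @ b # q'"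
    using parallel_decomp by blast
  \<comment> \<open>The two words agree on \<open>u @ [d]\<close>, so they diverge only after
    it.\<close>
  have "\<not> prefix p u"
  proof
    assume "prefix p u"
    then obtain s where s: "u = p @ s" by (auto simp: prefix_def)
    have "hd (s @ [d]) = a" "hd (s @ [d]) = b"
      using r(3) r'(3) div(2,3) s by (auto simp: prefix_def append_eq_Cons_conv) (cases s; simp)+
    then show False using div(1) by simp
  qed
  moreover have "prefix u r" "prefix p r"
    using r(1) div(2) by (auto simp: complete_return_def)
  ultimately have "prefix u p" "p \<noteq> u"
    using prefix_same_cases by auto
  then have "length u < length p"
    by (auto simp: prefix_def)
  define t v where "t = take (length p - length u) p" and "v = drop (length p - length u) p"
  have t: "p = t @ v" "length v = length u" "t \<noteq> []"
    using \<open>length u < length p\<close> by (auto simp: t_def v_def)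
  have "p @ [a] \<in> Fact w" "p @ [b] \<in> Fact w"
    using r(2) r'(2) div Fact_appendD1[of "p @ [a]" q w] Fact_appendD1[of "p @ [b]" q' w] by auto
  then have "right_special w p"
    using div(1) by (rule right_specialI)
  then have "v = u"
    using right_special_suffix[of w t v] uniq t by simp
  then have "r = t @ u @ (a # q)"
    using div(2) t by simp
  then show False
    using r(1) t(3) unfolding complete_return_def by blast
qed


section \<open>Episturmian words\<close>

context
  fixes w :: "'a word"
  assumes rec: "recurrent w" and epi: "episturmian w"
begin

section \<open>Reversal and special factors\<close>

lemma rev_in_Fact: "u \<in> Fact w \<Longrightarrow> rev u \<in> Fact w"
  using epi unfolding episturmian_def by blast

lemma left_special_unique:
  "left_special w u \<Longrightarrow> left_special w v \<Longrightarrow> length u = length v \<Longrightarrow> u = v"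
  using epi unfolding episturmian_def Uniq_def by blast

lemma right_special_rev: "right_special w u \<longleftrightarrow> left_special w (rev u)"
proof
  assume "right_special w u"
  then obtain a b where "a \<noteq> b" "u @ [a] \<in> Fact w" "u @ [b] \<in> Fact w"
    unfolding right_special_def by blast
  then show "left_special w (rev u)"
    using rev_in_Fact[of "u @ [a]"] rev_in_Fact[of "u @ [b]"] by (auto intro: left_specialI)
next
  assume "left_special w (rev u)"
  then obtain a b where "a \<noteq> b" "a # rev u \<in> Fact w" "b # rev u \<in> Fact w"
    unfolding left_special_def by blast
  then show "right_special w u"
    using rev_in_Fact[of "a # rev u"] rev_in_Fact[of "b # rev u"] by (auto intro: right_specialI)
qed

lemma right_special_unique:
  assumes "palindrome u" "left_special w u" "right_special w x" "length x = length u"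
  shows "x = u"
  using assms left_special_unique[of "rev x" u] unfolding right_special_rev palindrome_def
  by (metis length_rev rev_rev_ident)

text \<open>Since complete returns to \<open>u\<close> are palindromes, a return that starts with \<open>u @ [d]\<close> comes
  back to \<open>u\<close> through \<open>d\<close>, and must then leave through \<open>c\<close>: the word is trapped.\<close>

lemma trapped:
  assumes pal: "palindrome u"
    and ret: "\<And>r. r \<in> Fact w \<Longrightarrow> complete_return u r \<Longrightarrow> palindrome r"
  shows "\<not> left_special w (u @ [c]) \<Longrightarrow> \<not> left_special w (u @ [d]) \<Longrightarrow> z \<in> Fact w \<Longrightarrow>
    prefix (c # u @ [d]) z \<Longrightarrow> suffix (x # u @ [y]) z \<Longrightarrow>
    x = c \<and> y = d \<or> x = d \<and> y = c"
proof (induction "length z" arbitrary: z c d rule: less_induct)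
  case less
  obtain z1 where z1: "z = c # u @ d # z1"
    using less.prems(4) by (auto simp: prefix_def)
  obtain z2 where z2: "z = z2 @ x # u @ [y]"
    using less.prems(5) by (auto simp: suffix_def)
  have cud: "c # u @ [d] \<in> Fact w"
    using less.prems(3) z1 Fact_appendD1[of "c # u @ [d]" z1] by simp
  show ?case
  proof (cases z2)
    case Nil
    then show ?thesis using z1 z2 by auto
  next
    case (Cons c' z3)
    then have z3: "u @ d # z1 = (z3 @ x # u) @ [y]"
      using z1 z2 by simp
    \<comment> \<open>Without its first and last letters, \<open>z\<close> begins and ends with
      \<open>u\<close>; the first complete return inside is \<open>r\<close>.\<close>
    then have "prefix u ((z3 @ [x]) @ u)"
      by (metis prefixI append.assoc append_Cons append_Nil le_add2 length_append prefix_length_prefix)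
    then obtain r where r: "complete_return u r" "prefix r ((z3 @ [x]) @ u)"
      using ex_complete_return[of u "(z3 @ [x]) @ u"] suffixI by blast
    then obtain q where q: "z3 @ x # u = r @ q"
      by (auto simp: prefix_def)
    \<comment> \<open>The letter after \<open>r\<close> in \<open>z\<close> is \<open>g\<close>; it
      is \<open>y\<close> if \<open>r\<close> reaches the last \<open>u\<close>.\<close>
    obtain g q' where g: "q @ [y] = g # q'"
      by (cases "q @ [y]") auto
    have zr: "z = c # r @ g # q'"
      using z1 z3 q g by (metis append.assoc)
    obtain d' s e t where st: "r = u @ d' # s" "r = t @ e # u"
      using complete_return_ends[OF r(1)] .
    have "d' = d"
      using st(1) zr z1 by simp
    have "r \<in> Fact w"
      using less.prems(3) zr Fact_factor[of "[c]" r "g # q'"] by simp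
    then have "rev r = r"
      using ret r(1) unfolding palindrome_def by metis
    then have "r = (rev s @ [d]) @ u"
      using st(1) \<open>d' = d\<close> pal unfolding palindrome_def
      by (metis append.assoc append_Cons append_Nil rev.simps(2) rev_append)
    then have zs: "z = (c # rev s) @ (d # u @ g # q')"
      using zr by simp
    let ?z' = "d # u @ g # q'"
    have z'F: "?z' \<in> Fact w"
      using less.prems(3) zs Fact_appendD2 by blast
    have "d # u @ [g] \<in> Fact w"
      using z'F Fact_appendD1[of "d # u @ [g]" q'] by simp
    then have "g # u @ [d] \<in> Fact w"
      using rev_in_Fact[of "d # u @ [g]"] pal by (simp add: palindrome_def)
    then have "g = c"
      using cud less.prems(2) left_specialI[of g "u @ [d]" w c] by blast
    have "suffix (x # u @ [y]) ?z'"
    proof (rule suffix_length_suffix)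
      show "suffix (x # u @ [y]) z" by fact
      show "suffix ?z' z" using zs by (auto simp: suffix_def)
    qed simp
    moreover have "length ?z' < length z"
      using zs by simp
    \<comment> \<open>The induction hypothesis is used with \<open>c\<close> and \<open>d\<close>
      exchanged, which leaves the conclusion unchanged.\<close>
    ultimately show ?thesis
      using less.hyps[of ?z' d c] less.prems(1,2) z'F \<open>g = c\<close> by auto
  qed
qed

text \<open>If some \<open>u @ [b]\<close> is left special, it is the only one, and an extension of
  \<open>u\<close> avoiding \<open>b\<close> on both sides would trap the word, although
  \<open>b\<close> does follow \<open>u\<close>. If there is none, every extension is one fixed
  \<open>c # u @ [d]\<close> or its swap, so \<open>c\<close> dominates.\<close>

lemma dominated_if_palindromic_returns:
  assumes pal: "palindrome u" and "left_special w u"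
    and ret: "\<And>r. r \<in> Fact w \<Longrightarrow> complete_return u r \<Longrightarrow> palindrome r"
  shows "\<exists>a. dominates w a u"
proof -
  have swap: "x = c \<and> y = d \<or> x = d \<and> y = c"
    if ext: "c # u @ [d] \<in> Fact w" "x # u @ [y] \<in> Fact w"
      and not_ls: "\<not> left_special w (u @ [c])" "\<not> left_special w (u @ [d])" for c d x y
  proof -
    obtain s where "(c # u @ [d]) @ s @ (x # u @ [y]) \<in> Fact w"
      using recurrent_connect[OF rec ext] by blast
    then show ?thesis
      using trapped[OF pal ret not_ls, of "(c # u @ [d]) @ s @ (x # u @ [y])" x y]
      by (auto simp: suffix_def)
  qed
  show ?thesis
  proof (cases "\<exists>b. left_special w (u @ [b])")
    case True
    then obtain b where b: "left_special w (u @ [b])" by blast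
    then obtain x where x: "x # u @ [b] \<in> Fact w"
      unfolding left_special_def by auto
    have "c = b \<or> d = b" if "c # u @ [d] \<in> Fact w" for c d
      using swap[OF that x] left_special_unique[OF b] by fastforce
    then show ?thesis
      unfolding dominates_def by blast
  next
    case False
    then show ?thesis
      using swap unfolding dominates_def by metis
  qed
qed

text \<open>With \<open>v\<close> the longest proper palindromic prefix of \<open>u\<close>, the word \<open>u\<close> is the complete
  return to \<open>v\<close> leaving through the letter \<open>x\<close> that dominates \<open>v\<close>. Hence a complete return to
  \<open>u\<close> decomposes into at most three successive complete returns to \<open>v\<close>, the outer ones being
  \<open>u\<close>.\<close>

lemma palindromic_returns:
  assumes "palindrome u" "left_special w u" "r \<in> Fact w" "complete_return u r"
  shows "palindrome r"
  using assms
proof (induction "length u" arbitrary: u r rule: less_induct)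
  case less
  note pal = less.prems(1) and ls = less.prems(2)
  have ru: "rev u = u" using pal by (simp add: palindrome_def)
  show ?case
  proof (cases "u = []")
    case True
    then have inner: "p = [] \<or> q = []" if "r = p @ q" for p q
      using less.prems(4) that by (auto simp: complete_return_def)
    have "r \<noteq> []"
      using less.prems(4) True by (auto simp: complete_return_def)
    then obtain a r' where "r = [a] @ r'"
      by (cases r) auto
    then have "r = [a]" using inner by blast
    then show ?thesis by (simp add: palindrome_def)
  next
    case False
    let ?P = "\<lambda>v. prefix v u \<and> v \<noteq> u \<and> palindrome v"
    have "?P []" using False by (simp add: palindrome_def)
    moreover have "\<forall>v. ?P v \<longrightarrow> length v < Suc (length u)"
      by (auto dest: prefix_length_le)
    ultimately obtain v where v: "?P v" and vmax: "\<And>v'. ?P v' \<Longrightarrow> length v' \<le> length v"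
      using ex_has_greatest_nat[of ?P "[]" length "Suc (length u)"] by blast
    have rv: "rev v = v" using v by (simp add: palindrome_def)
    obtain x u1 where u1: "u = v @ x # u1"
      using v unfolding prefix_def by (metis append_Nil2 list.exhaust)
    have u2: "u = (rev u1 @ [x]) @ v"
      using arg_cong[OF u1, of rev] ru rv by simp
    have lv: "length v < length u" using u1 by simp
    have lsv: "left_special w v" and lsvx: "left_special w (v @ [x])"
      using ls u1 left_special_prefix[of w v "x # u1"] left_special_prefix[of w "v @ [x]" u1]
      by auto
    have retv: "palindrome r'" if "r' \<in> Fact w" "complete_return v r'" for r'
      using less.hyps[OF lv _ lsv that] v by blast
    have "\<exists>a. dominates w a v"
      by (rule dominated_if_palindromic_returns) (use v lsv retv in auto)
    then have domx: "dominates w x v"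
      using dominates_left_special[OF _ lsvx] by metis
    have uF: "u \<in> Fact w" using ls by (simp add: left_special_def)
    \<comment> \<open>An inner occurrence of \<open>v\<close> would yield a complete return to
      \<open>v\<close> that is a proper prefix of \<open>u\<close>: a palindrome longer than
      \<open>v\<close>.\<close>
    have cru: "complete_return v u"
    proof -
      have "p = [] \<or> q = []" if pq: "u = p @ v @ q" for p q
      proof (rule ccontr)
        assume neq: "\<not> ?thesis"
        have pre: "prefix (p @ v) u" using pq by simp
        then have "prefix v (p @ v)"
          using v by (metis le_add2 length_append prefix_length_prefix)
        then obtain r' where r': "complete_return v r'" "prefix r' (p @ v)"
          using ex_complete_return[of v "p @ v"] neq suffixI by blast
        have pr: "prefix r' u" using r' pre by (meson prefix_order.trans)
        then have "r' \<in> Fact w" using uF Fact_appendD1 by (auto simp: prefix_def)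
        then have "palindrome r'" using retv r' by blast
        moreover have "length r' < length u"
          using prefix_length_le[OF r'(2)] pq neq by (cases q) auto
        ultimately have "length r' \<le> length v"
          using vmax pr by blast
        then show False
          using complete_return_ends[OF r'(1)]
          by (metis add_Suc_right le_add1 length_Cons length_append not_less_eq_eq)
      qed
      then show ?thesis
        using v u2 unfolding complete_return_def by (auto simp: suffix_def)
    qed
    \<comment> \<open>Since \<open>r\<close> ends with \<open>u\<close>, hence with
      \<open>v\<close>, each earlier occurrence of \<open>v\<close> starts a complete return inside
      \<open>r\<close>.\<close>
    have next_return: "\<exists>r'. complete_return v r' \<and> prefix (v @ [g]) r' \<and> prefix r' (v @ g # s)
        \<and> r' \<in> Fact w"
      if rs: "r = t @ v @ g # s" for t g s
    proof -
      have "suffix v (v @ g # s)"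
      proof (rule suffix_length_suffix)
        show "suffix v r"
          using less.prems(4) u2 unfolding complete_return_def
          by (metis suffixI suffix_order.trans)
        show "suffix (v @ g # s) r" using rs by (auto simp: suffix_def)
      qed simp
      then obtain r' where r': "complete_return v r'" "prefix r' (v @ g # s)"
        using ex_complete_return[of v "v @ g # s"] by auto
      obtain g' s' where "r' = v @ g' # s'"
        using complete_return_ends[OF r'(1)] .
      then have "prefix (v @ [g]) r'" using r'(2) by auto
      moreover have "v @ g # s \<in> Fact w"
        using less.prems(3) rs Fact_appendD2 by blast
      then have "r' \<in> Fact w" using r'(2) Fact_appendD1 by (auto simp: prefix_def)
      ultimately show ?thesis using r' by blast
    qed
    have next_u: "s' = [] \<or> t = []"
      if rs: "r = t @ u @ s'" for t s'
      using less.prems(4) rs unfolding complete_return_def by blast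
    \<comment> \<open>The return through \<open>x\<close> is \<open>u\<close>; not being at the
      start of \<open>r\<close>, this \<open>u\<close> must end it.\<close>
    have next_x: "r = t @ u" if rs: "r = t @ v @ x # s" and "t \<noteq> []" for t s
    proof -
      obtain r' where r': "complete_return v r'" "prefix (v @ [x]) r'"
        "prefix r' (v @ x # s)" "r' \<in> Fact w"
        using next_return[OF rs] by blast
      have "r' = u"
      proof (rule complete_return_unique[OF _ r'(1,4,2) cru uF])
        show "y = v" if "right_special w y" "length y = length v" for y
          using right_special_unique[OF _ lsv that] v by blast
        show "prefix (v @ [x]) u" using u1 by simp
      qed
      then obtain s' where "r = t @ u @ s'"
        using r'(3) rs by (auto simp: prefix_def)
      then show ?thesis using next_u \<open>t \<noteq> []\<close> by auto
    qed
    obtain d s e t where st: "r = u @ d # s" "r = t @ e # u"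
      using complete_return_ends[OF less.prems(4)] .
    have rd: "r = (rev u1 @ [x]) @ v @ d # s"
      using st(1) u2 by (metis append.assoc)
    \<comment> \<open>If \<open>d = x\<close>, the second return to \<open>v\<close> is already the
      final \<open>u\<close>. Otherwise it is a palindrome ending in \<open>d # v\<close>. It cannot
      end \<open>r\<close>, where \<open>x\<close> precedes the last \<open>v\<close>, so domination
      makes the next letter \<open>x\<close>, and the third return is the final \<open>u\<close>,
      preceded by \<open>d\<close>.\<close>
    have "d = e"
    proof (cases "d = x")
      case True
      then have "r = (rev u1 @ [x]) @ u"
        using next_x rd by blast
      then show ?thesis using st(2) True by simp
    next
      case False
      obtain r1 where r1: "complete_return v r1" "prefix (v @ [d]) r1"
        "prefix r1 (v @ d # s)" "r1 \<in> Fact w"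
        using next_return[OF rd] by blast
      obtain r2 where "r1 = v @ d # r2"
        using r1(2) by (auto simp: prefix_def)
      then have r1d: "r1 = rev r2 @ d # v"
        using retv[OF r1(4,1)] rv unfolding palindrome_def
        by (metis append.assoc append_Cons append_Nil rev.simps(2) rev_append)
      obtain s1 where s1: "v @ d # s = r1 @ s1"
        using r1(3) by (auto simp: prefix_def)
      let ?t = "(rev u1 @ [x]) @ rev r2 @ [d]"
      have rt: "r = ?t @ v @ s1"
        using rd s1 r1d by simp
      have "s1 \<noteq> []"
      proof
        assume "s1 = []"
        then have "((rev u1 @ [x]) @ rev r2 @ [d]) @ v = (t @ e # rev u1 @ [x]) @ v"
          using rt st(2) u2 by simp
        then show False using False by simp
      qed
      then obtain g s2 where g: "s1 = g # s2"
        by (auto simp: neq_Nil_conv)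
      have "d # v @ [g] \<in> Fact w"
        using less.prems(3) rt g Fact_factor[of "(rev u1 @ [x]) @ rev r2" "d # v @ [g]" s2]
        by simp
      then have "g = x"
        using domx False unfolding dominates_def by blast
      then have "r = ?t @ u"
        using next_x[of ?t s2] rt g by blast
      then show ?thesis using st(2) by simp
    qed
    \<comment> \<open>As \<open>d = e\<close>, both are complete returns to \<open>u\<close> that
      leave it through \<open>d\<close>.\<close>
    have "rev r = r"
    proof (rule complete_return_unique)
      show "x = u" if "right_special w x" "length x = length u" for x
        using right_special_unique[OF pal ls that] .
      show "complete_return u (rev r)"
        using complete_return_rev[OF less.prems(4)] ru by simp
      show "rev r \<in> Fact w" using rev_in_Fact less.prems(3) .
      show "prefix (u @ [d]) r" using st(1) by simp
      have "rev r = u @ e # rev t" using st(2) ru by simp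
      then show "prefix (u @ [d]) (rev r)" using \<open>d = e\<close> by simp
    qed (use less.prems in auto)
    then show ?thesis by (simp add: palindrome_def)
  qed
qed

text \<open>If \<open>u\<close> is not left special, its only left letter dominates, and
  symmetrically on the right; a bispecial \<open>u\<close> equals its mirror image by
  uniqueness.\<close>

lemma episturmian_dominated:
  assumes "u \<in> Fact w"
  shows "\<exists>a. dominates w a u"
proof (cases "left_special w u \<and> right_special w u")
  case True
  then have "palindrome u"
    using left_special_unique[of u "rev u"] unfolding right_special_rev palindrome_def by simp
  then show ?thesis
    using True dominated_if_palindromic_returns palindromic_returns by blast
next
  case False
  obtain a b where ab: "a # u \<in> Fact w" "u @ [b] \<in> Fact w"
    using recurrent_extend_left[OF rec assms] recurrent_extend_right[OF rec assms] by blast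
  have "c # u \<in> Fact w" "u @ [d] \<in> Fact w" if "c # u @ [d] \<in> Fact w" for c d
    using that Fact_appendD1[of "c # u" "[d]"] Fact_ConsD by auto
  then have "dominates w a u \<or> dominates w b u"
    using False ab left_specialI right_specialI unfolding dominates_def by metis
  then show ?thesis by blast
qed

end

theorem theorem4:
  fixes A :: "'a set" and w :: "'a word"
  assumes "finite A"
    and "range w \<subseteq> A"
    and "recurrent w"
  shows "(episturmian w \<longleftrightarrow>
            (\<forall>u\<in>Fact w. \<exists>a\<in>A. ext_set A u A \<inter> Fact w \<subseteq> ext_set {a} u A \<union> ext_set A u {a}))
       \<and> (episturmian w \<longleftrightarrow>
            (\<forall>u\<in>Fact w. palindrome u \<longrightarrow>
               (\<exists>a\<in>A. ext_set A u A \<inter> Fact w \<subseteq> ext_set {a} u A \<union> ext_set A u {a})))"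
  unfolding ex_ext_set_iff_dominates[OF assms(2)]
  using episturmian_dominated[OF assms(3)] episturmian_if_dominated_palindromes[OF assms(3)]
  by blast

end
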